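(* Let $\widehat{A}=A+\epsilon B\in\mathbb{DR}^{n\times n}$ with $\operatorname{Ind}(A)=m$. If $\widehat{A}$ has a dual Drazin generalized inverse $\widehat{A}^{D}$ and $\widehat{A}^{D}=A^{D}-\epsilon A^{D}BA^{D}$, then the dual core-EP generalized inverse $\widehat{A}^{\dagger_c}$ exists and $\widehat{A}^{\dagger_c}=A^{\dagger_c}-\epsilon A^{\dagger_c}BA^{\dagger_c}$.
   Context: Dual numbers are $a+\epsilon b$ with $a,b\in\mathbb{R}$, $\epsilon\neq 0$, $\epsilon^2=0$. $\mathbb{DR}^{n\times n}$ is the set of dual real matrices $\widehat{A}=A+\epsilon B$, $A,B\in\mathbb{R}^{n\times n}$, with product $(A+\epsilon B)(C+\epsilon D)=AC+\epsilon(AD+BC)$ and transpose $(A+\epsilon B)^T=A^T+\epsilon B^T$. $\operatorname{Ind}(A)$ is the smallest nonnegative integer $s$ with $\operatorname{rank}(A^{s+1})=\operatorname{rank}(A^s)$. For a real square matrix $A$ of index $m$, $A^{D}$ is the Drazin inverse and $A^{\dagger_c}$ the core-EP inverse, the unique real $X$ with $(AX)^T=AX$, $AX^2=X$, $XA^{m+1}=A^m$. For $\widehat{A}=A+\epsilon B$ with $\operatorname{Ind}(A)=m$: the dual Drazin generalized inverse $\widehat{A}^{D}$ is the $\widehat{X}$ (unique if it exists) with $\widehat{X}\widehat{A}^{m+1}=\widehat{A}^m$, $\widehat{X}\widehat{A}\widehat{X}=\widehat{X}$, $\widehat{A}\widehat{X}=\widehat{X}\widehat{A}$; the dual core-EP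 generalized inverse $\widehat{A}^{\dagger_c}$ is the $\widehat{X}\in\mathbb{DR}^{n\times n}$ (unique if it exists) with $(\widehat{A}\widehat{X})^{T}=\widehat{A}\widehat{X}$, $\widehat{A}\widehat{X}^{2}=\widehat{X}$, $\widehat{X}\widehat{A}^{m+1}=\widehat{A}^{m}$. *)

theory Defs
  imports "HOL-Analysis.Analysis"
begin

datatype dual = Dual (std_part: real) (inf_part: real)

instantiation dual :: comm_ring_1
begin

definition "0 = Dual 0 0"
definition "1 = Dual 1 0"
definition "x + y = Dual (std_part x + std_part y) (inf_part x + inf_part y)"
definition "- x = Dual (- std_part x) (- inf_part x)"
definition "x - y = Dual (std_part x - std_part y) (inf_part x - inf_part y)"
definition "x * y = Dual (std_part x * std_part y)
  (std_part x * inf_part y + inf_part x * std_part y)"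

instance
  by standard
    (auto simp: zero_dual_def one_dual_def plus_dual_def uminus_dual_def minus_dual_def
      times_dual_def algebra_simps)

end

definition dual_eps :: dual where
  "dual_eps = Dual 0 1"

lemma dual_eps_neq_0: "dual_eps \<noteq> 0"
  and dual_eps_square: "dual_eps * dual_eps = 0"
  by (simp_all add: dual_eps_def zero_dual_def times_dual_def)

lemma Dual_eq: "Dual a b = Dual a 0 + dual_eps * Dual b 0"
  by (simp add: dual_eps_def plus_dual_def times_dual_def)

text \<open>\<open>dual_mat A B\<close> is the dual matrix \<open>A + \<epsilon> B\<close>.\<close>

definition dual_mat :: "real^'n^'m \<Rightarrow> real^'n^'m \<Rightarrow> dual^'n^'m" where
  "dual_mat A B = (\<chi> i j. Dual (A $ i $ j) (B $ i $ j))"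

definition std_mat :: "dual^'n^'m \<Rightarrow> real^'n^'m" where
  "std_mat M = map_matrix std_part M"

lemma std_mat_dual_mat [simp]: "std_mat (dual_mat A B) = A"
  by (simp add: std_mat_def dual_mat_def map_matrix_def vec_eq_iff)

lemma dual_mat_cases: obtains A B where "M = dual_mat A B"
proof
  show "M = dual_mat (map_matrix std_part M) (map_matrix inf_part M)"
    by (simp add: dual_mat_def vec_eq_iff)
qed

lemma dual_mat_eq_iff [simp]: "dual_mat A B = dual_mat C D \<longleftrightarrow> A = C \<and> B = D"
  by (auto simp: dual_mat_def vec_eq_iff)

lemma std_part_sum: "std_part (sum f S) = (\<Sum>x\<in>S. std_part (f x))"
  by (induction S rule: infinite_finite_induct) (auto simp: zero_dual_def plus_dual_def)

lemma inf_part_sum: "inf_part (sum f S) = (\<Sum>x\<in>S. inf_part (f x))"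
  by (induction S rule: infinite_finite_induct) (auto simp: zero_dual_def plus_dual_def)

lemma dual_mat_mult:
  "dual_mat A B ** dual_mat C D = dual_mat (A ** C) (A ** D + B ** C)"
  by (simp add: dual_mat_def matrix_matrix_mult_def vec_eq_iff dual.expand std_part_sum
      inf_part_sum times_dual_def sum.distrib)

lemma transpose_dual_mat: "transpose (dual_mat A B) = dual_mat (transpose A) (transpose B)"
  by (simp add: dual_mat_def transpose_def)

lemma mat_1_dual_mat: "mat 1 = dual_mat (mat 1) 0"
  by (auto simp: dual_mat_def mat_def vec_eq_iff one_dual_def zero_dual_def)

text \<open>The library's \<open>^\<close> on \<open>'a^'n^'n\<close> is the componentwise power, hence a separate matrix power.\<close>

primrec mat_pow :: "'a::semiring_1^'n^'n \<Rightarrow> nat \<Rightarrow> 'a^'n^'n" where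
  "mat_pow A 0 = mat 1"
| "mat_pow A (Suc k) = A ** mat_pow A k"

definition mat_index :: "real^'n^'n \<Rightarrow> nat" where
  "mat_index A = (LEAST s. rank (mat_pow A (s + 1)) = rank (mat_pow A s))"

text \<open>The defining equations are the same for real and for dual matrices. In both cases \<open>m\<close> is the
  index of a real matrix, for a dual matrix that of its standard part.\<close>

definition is_drazin :: "nat \<Rightarrow> 'a::semiring_1^'n^'n \<Rightarrow> 'a^'n^'n \<Rightarrow> bool" where
  "is_drazin m A X \<longleftrightarrow>
     X ** mat_pow A (m + 1) = mat_pow A m \<and> X ** A ** X = X \<and> A ** X = X ** A"

definition is_core_ep :: "nat \<Rightarrow> 'a::semiring_1^'n^'n \<Rightarrow> 'a^'n^'n \<Rightarrow> bool" where
  "is_core_ep m A X \<longleftrightarrow>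
     transpose (A ** X) = A ** X \<and> A ** mat_pow X 2 = X \<and> X ** mat_pow A (m + 1) = mat_pow A m"

definition drazin :: "real^'n^'n \<Rightarrow> real^'n^'n" where
  "drazin A = (THE X. is_drazin (mat_index A) A X)"

definition core_ep :: "real^'n^'n \<Rightarrow> real^'n^'n" where
  "core_ep A = (THE X. is_core_ep (mat_index A) A X)"

definition dual_drazin :: "dual^'n^'n \<Rightarrow> dual^'n^'n" where
  "dual_drazin M = (THE X. is_drazin (mat_index (std_mat M)) M X)"

definition dual_core_ep :: "dual^'n^'n \<Rightarrow> dual^'n^'n" where
  "dual_core_ep M = (THE X. is_core_ep (mat_index (std_mat M)) M X)"

text \<open>Uniqueness justifies the definite descriptions above.\<close>

lemma mat_pow_commute: "mat_pow A k ** A = A ** mat_pow A k"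
  by (induction k) (simp_all add: matrix_mul_assoc [symmetric])

lemma mat_pow_commute': "A ** X = X ** A \<Longrightarrow> mat_pow A k ** X = X ** mat_pow A k"
proof (induction k)
  case (Suc k)
  then show ?case by (simp add: matrix_mul_assoc [symmetric]) (simp add: matrix_mul_assoc)
qed simp

lemma is_drazin_unique:
  fixes A :: "'a::semiring_1^'n^'n"
  assumes X: "is_drazin m A X" and Y: "is_drazin m A Y"
  shows "X = Y"
proof -
  have expand: "\<exists>W. Z = mat_pow A k ** W \<and> Z = W ** mat_pow A k" if Z: "is_drazin m A Z" for Z k
  proof (induction k)
    case 0
    then show ?case by simp
  next
    case (Suc k)
    have c: "A ** Z = Z ** A" and i: "Z ** A ** Z = Z" using Z by (auto simp: is_drazin_def)
    obtain W where W: "Z = mat_pow A k ** W" "Z = W ** mat_pow A k" using Suc by blast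
    have p: "mat_pow A (Suc k) ** (mat_pow Z (Suc (Suc k))) = Z" for k
    proof (induction k)
      case 0
      then show ?case using c i by (simp add: matrix_mul_assoc)
    next
      case (Suc k)
      have "mat_pow A (Suc (Suc k)) ** mat_pow Z (Suc (Suc (Suc k)))
          = A ** (mat_pow A (Suc k) ** Z) ** mat_pow Z (Suc (Suc k))"
        by (simp add: matrix_mul_assoc)
      also have "\<dots> = A ** (Z ** mat_pow A (Suc k)) ** mat_pow Z (Suc (Suc k))"
        by (simp only: mat_pow_commute' [OF c])
      also have "\<dots> = A ** Z ** (mat_pow A (Suc k) ** mat_pow Z (Suc (Suc k)))"
        by (simp only: matrix_mul_assoc)
      also have "\<dots> = A ** Z ** Z" by (simp only: Suc)
      also have "\<dots> = Z" by (simp add: c i)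
      finally show ?case .
    qed
    have "mat_pow A (Suc k) ** mat_pow Z (Suc (Suc k)) = mat_pow Z (Suc (Suc k)) ** mat_pow A (Suc k)"
      by (metis c mat_pow_commute')
    then show ?case using p[of k] by metis
  qed
  have idem: "Z ** A ** mat_pow A m = mat_pow A m" "mat_pow A m ** (A ** Z) = mat_pow A m"
    if Z: "is_drazin m A Z" for Z
  proof -
    have c: "A ** Z = Z ** A" and e: "Z ** mat_pow A (m + 1) = mat_pow A m"
      using Z by (auto simp: is_drazin_def)
    show 1: "Z ** A ** mat_pow A m = mat_pow A m" using e by (simp add: matrix_mul_assoc)
    have "mat_pow A m ** (A ** Z) = (A ** Z) ** mat_pow A m"
      by (metis c mat_pow_commute mat_pow_commute' matrix_mul_assoc)
    then show "mat_pow A m ** (A ** Z) = mat_pow A m" using 1 c by simp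
  qed
  obtain V where V: "Y = mat_pow A m ** V" using expand[OF Y, of m] by blast
  obtain W where W: "X = W ** mat_pow A m" using expand[OF X, of m] by blast
  have "X ** A ** Y = Y" using idem(1)[OF X] V by (metis matrix_mul_assoc)
  moreover have "X ** (A ** Y) = X" using idem(2)[OF Y] W by (metis matrix_mul_assoc)
  ultimately show ?thesis by (simp add: matrix_mul_assoc)
qed

lemma is_core_ep_unique:
  fixes A :: "'a::comm_semiring_1^'n^'n"
  assumes X: "is_core_ep m A X" and Y: "is_core_ep m A Y"
  shows "X = Y"
proof -
  have expand: "Z = mat_pow A k ** mat_pow Z (Suc k)" if Z: "is_core_ep m A Z" for Z k
  proof (induction k)
    case (Suc k)
    have sq: "A ** (Z ** Z) = Z" using Z by (simp add: is_core_ep_def numeral_2_eq_2)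
    have "Z = mat_pow A k ** (A ** (Z ** Z) ** mat_pow Z k)"
      using Suc by (simp add: sq)
    then show ?case
      by (simp add: matrix_mul_assoc mat_pow_commute)
  qed simp
  have sub: "Z ** (A ** W) = W" "A ** Z ** (A ** W) = A ** W"
    if Z: "is_core_ep m A Z" and W: "is_core_ep m A W" for Z W
  proof -
    have e: "Z ** (A ** mat_pow A m) = mat_pow A m" using Z by (simp add: is_core_ep_def)
    obtain V where V: "W = mat_pow A m ** V" using expand[OF W, of m] by blast
    show 1: "Z ** (A ** W) = W" using e unfolding V by (metis matrix_mul_assoc)
    show "A ** Z ** (A ** W) = A ** W" using 1 by (metis matrix_mul_assoc)
  qed
  have "A ** Y = transpose (A ** X ** (A ** Y))"
    using sub(2)[OF X Y] Y by (simp add: is_core_ep_def)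
  also have "\<dots> = A ** Y ** (A ** X)"
    using X Y unfolding is_core_ep_def by (simp add: matrix_transpose_mul)
  also have "\<dots> = A ** X" by (rule sub(2)[OF Y X])
  finally have "A ** Y = A ** X" .
  then show ?thesis using sub(1)[OF X X] sub(1)[OF X Y] by simp
qed

end

theory Submission
  imports Defs
begin

text \<open>Write \<open>M = A + \<epsilon>B\<close>, \<open>D = A\<^sup>D\<close> and \<open>P = A D\<close>. The idempotent \<open>P\<close> projects onto the range of
  \<open>A\<^sup>m\<close>. Over any semiring, the Drazin and the core-EP inverse of a matrix differ only by an
  orthogonal projector: if \<open>X\<close> is a Drazin inverse of \<open>M\<close> and \<open>Q\<close> is symmetric with the same range as
  the idempotent \<open>M X\<close>, then \<open>X Q\<close> satisfies the core-EP equations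
  (\<open>is_core_ep_drazin_mult_projector\<close>). For a real idempotent such a \<open>Q\<close> always exists
  (\<open>ex_symmetric_projector_same_range\<close>), which settles the real matrix \<open>A\<close>: \<open>A\<^sup>\<dagger>\<^sup>c = D Q\<close>.

  For the dual matrix, the assumed form of the Drazin inverse, \<open>X = D - \<epsilon>DBD\<close>, together with
  \<open>M X = X M\<close> forces \<open>P B D = B D\<close> (\<open>drazin_perturbation_range\<close>). Two consequences
  follow. First, \<open>M X = P\<close> has no infinitesimal part, so the same real \<open>Q\<close> serves for \<open>M\<close> and \<open>X Q\<close>
  is the dual core-EP inverse. Second, \<open>Q\<close> fixes the range of \<open>B D\<close>, so the infinitesimal part
  \<open>- D B D Q\<close> of \<open>X Q\<close> equals \<open>- (D Q) B (D Q)\<close>.\<close>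

lemma matrix_mul_add_rdistrib:
  fixes A B :: "'a::semiring_1^'n^'m"
  shows "(A + B) ** C = A ** C + B ** C"
  by (simp add: matrix_matrix_mult_def vec_eq_iff algebra_simps sum.distrib)

lemma matrix_mul_minus:
  fixes A :: "'a::ring_1^'n^'m"
  shows "A ** (- B) = - (A ** B)" "(- A) ** B = - (A ** B)"
  by (simp_all add: matrix_matrix_mult_def vec_eq_iff sum_negf)

lemma matrix_mul_diff_distrib:
  fixes A :: "'a::ring_1^'n^'m"
  shows "A ** (B - C) = A ** B - A ** C" "(A - A') ** B = A ** B - A' ** B"
  by (simp_all add: matrix_matrix_mult_def vec_eq_iff algebra_simps sum_subtractf)

lemma is_drazin_mult_square:
  assumes "is_drazin m A X"
  shows "A ** X ** X = X"
  using assms by (simp add: is_drazin_def)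

text \<open>Symmetry holds because \<open>A X Q = Q\<close>. The other two equations are inherited from \<open>X\<close>, since \<open>Q\<close>
  fixes the range of \<open>A X\<close>, and the columns of \<open>X\<close> and of \<open>A\<^sup>m\<close> lie there.\<close>

lemma is_core_ep_drazin_mult_projector:
  fixes A X Q :: "'a::semiring_1^'n^'n"
  assumes X: "is_drazin m A X"
    and sym: "transpose Q = Q"
    and QP: "Q ** (A ** X) = A ** X" and PQ: "A ** X ** Q = Q"
  shows "is_core_ep m A (X ** Q)"
proof -
  have comm: "A ** X = X ** A" and pow: "X ** (A ** mat_pow A m) = mat_pow A m"
    using X by (auto simp: is_drazin_def)
  have QX: "Q ** X = X"
    using is_drazin_mult_square[OF X] QP by (metis matrix_mul_assoc)
  have Qpow: "Q ** mat_pow A m = mat_pow A m"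
    using pow comm QP by (metis matrix_mul_assoc)
  have "transpose (A ** (X ** Q)) = A ** (X ** Q)"
    using sym PQ by (simp add: matrix_mul_assoc)
  moreover have "A ** mat_pow (X ** Q) 2 = X ** Q"
  proof -
    have "A ** mat_pow (X ** Q) 2 = A ** X ** (Q ** X) ** Q"
      by (simp add: numeral_2_eq_2 matrix_mul_assoc)
    then show ?thesis
      using is_drazin_mult_square[OF X] by (simp add: QX)
  qed
  moreover have "X ** Q ** mat_pow A (m + 1) = mat_pow A m"
  proof -
    have "X ** Q ** mat_pow A (m + 1) = X ** (Q ** mat_pow A m) ** A"
      by (simp add: mat_pow_commute [symmetric] matrix_mul_assoc)
    also have "\<dots> = X ** (A ** mat_pow A m)"
      by (simp add: Qpow mat_pow_commute flip: matrix_mul_assoc)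
    finally show ?thesis by (simp add: pow)
  qed
  ultimately show ?thesis
    by (simp add: is_core_ep_def)
qed

lemma gram_matrix_vector_eq_0_iff:
  fixes A :: "real^'n^'m"
  shows "transpose A *v (A *v x) = 0 \<longleftrightarrow> A *v x = 0"
proof
  assume "transpose A *v (A *v x) = 0"
  moreover have "(A *v x) \<bullet> (A *v x) = x \<bullet> (transpose A *v (A *v x))"
    by (metis dot_lmul_matrix vector_transpose_matrix inner_commute)
  ultimately show "A *v x = 0" by simp
qed simp

text \<open>The orthogonal projector is \<open>P S\<^sup>-\<^sup>1\<close> with \<open>S = P + P\<^sup>T - 1\<close>. Idempotence gives
  \<open>P S = P P\<^sup>T = S P\<^sup>T\<close> and \<open>P\<^sup>T S = P\<^sup>T P = S P\<close>. Hence \<open>S x = 0\<close> gives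
  \<open>P P\<^sup>T x = P\<^sup>T P x = 0\<close>, so \<open>P\<^sup>T x = P x = 0\<close> by positive definiteness of the inner product, and
  \<open>x = P x + P\<^sup>T x - S x = 0\<close>. So \<open>S\<close> is invertible, and moving \<open>S\<^sup>-\<^sup>1\<close> across \<open>P\<close> exchanges \<open>P\<close> and \<open>P\<^sup>T\<close>.\<close>

lemma ex_symmetric_projector_same_range:
  fixes P :: "real^'n^'n"
  assumes idem: "P ** P = P"
  obtains Q where "transpose Q = Q" "Q ** P = P" "P ** Q = Q"
proof -
  define S where "S = P + transpose P - mat 1"
  have idemT: "transpose P ** transpose P = transpose P"
    by (metis idem matrix_transpose_mul)
  have PS: "P ** S = P ** transpose P" and SPT: "S ** transpose P = P ** transpose P"
    and PTS: "transpose P ** S = transpose P ** P" and SP: "S ** P = transpose P ** P"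
    by (simp_all add: S_def matrix_add_ldistrib matrix_mul_add_rdistrib
        matrix_mul_diff_distrib idem idemT)
  have "x = 0" if x: "S *v x = 0" for x
  proof -
    have "P *v (transpose P *v x) = P *v (S *v x)"
      by (simp add: matrix_vector_mul_assoc PS del: transpose_matrix_vector)
    then have "transpose P *v x = 0"
      using gram_matrix_vector_eq_0_iff[of "transpose P" x] by (simp add: x)
    moreover have "transpose P *v (P *v x) = transpose P *v (S *v x)"
      by (simp add: matrix_vector_mul_assoc PTS del: transpose_matrix_vector)
    then have "P *v x = 0"
      using gram_matrix_vector_eq_0_iff[of P x] by (simp add: x)
    ultimately show "x = 0"
      using x by (simp add: S_def matrix_vector_mult_add_rdistrib matrix_vector_mult_diff_rdistrib)
  qed
  then obtain T where TS: "T ** S = mat 1"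
    using matrix_left_invertible_ker[of S] by blast
  then have ST: "S ** T = mat 1"
    by (simp add: matrix_left_right_inverse)
  have symS: "transpose S = S"
    by (simp add: S_def transpose_def mat_def vec_eq_iff add.commute)
  have symT: "transpose T = T"
    by (metis ST TS symS matrix_transpose_mul transpose_mat matrix_mul_assoc matrix_mul_lid
        matrix_mul_rid)
  show thesis
  proof
    have "P ** T = T ** (S ** P) ** T"
      by (simp add: matrix_mul_assoc TS)
    also have "\<dots> = T ** transpose P ** (S ** T)"
      by (simp add: SP PTS[symmetric] matrix_mul_assoc)
    finally have "P ** T = T ** transpose P"
      by (simp add: ST)
    then show "transpose (P ** T) = P ** T"
      by (simp add: matrix_transpose_mul symT)
    have "T ** P = T ** (P ** S) ** T"
      by (metis ST matrix_mul_assoc matrix_mul_rid)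
    also have "\<dots> = T ** S ** transpose P ** T"
      by (simp add: PS SPT[symmetric] matrix_mul_assoc)
    finally have "T ** P = transpose P ** T"
      by (simp add: TS)
    then have "P ** T ** P = P ** S ** T"
      by (metis PS matrix_mul_assoc)
    then show "P ** T ** P = P"
      by (metis ST matrix_mul_assoc matrix_mul_rid)
    show "P ** (P ** T) = P ** T"
      by (simp add: matrix_mul_assoc idem)
  qed
qed

lemma mat_pow_dual_mat: "\<exists>C. mat_pow (dual_mat A B) k = dual_mat (mat_pow A k) C"
proof (induction k)
  case 0
  then show ?case by (auto simp: mat_1_dual_mat)
next
  case (Suc k)
  then show ?case by (auto simp: dual_mat_mult)
qed

lemma is_drazin_standard_part:
  assumes "is_drazin m (dual_mat A B) (dual_mat X Y)"
  shows "is_drazin m A X"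
proof -
  obtain C where "mat_pow (dual_mat A B) m = dual_mat (mat_pow A m) C"
    using mat_pow_dual_mat by blast
  then show ?thesis
    using assms by (simp add: is_drazin_def dual_mat_mult)
qed

text \<open>The infinitesimal part of commutativity reads \<open>(1 - P) B D = D B (1 - P)\<close> for \<open>P = A D\<close>.
  Multiplying by \<open>P\<close> on the left kills the left side and keeps the right side, so both vanish.\<close>

lemma drazin_perturbation_range:
  fixes A B D :: "real^'n^'n"
  assumes "is_drazin m (dual_mat A B) (dual_mat D (- (D ** B ** D)))"
  shows "A ** D ** B ** D = B ** D"
proof -
  have comm: "A ** D = D ** A" and AD: "A ** D ** D = D"
    using is_drazin_standard_part[OF assms] is_drazin_mult_square
    by (auto simp: is_drazin_def)
  have idem: "A ** D ** (A ** D) = A ** D"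
    using AD comm by (metis matrix_mul_assoc)
  have eq: "B ** D - A ** D ** B ** D = D ** B - D ** B ** D ** A"
  proof -
    have "dual_mat A B ** dual_mat D (- (D ** B ** D))
        = dual_mat D (- (D ** B ** D)) ** dual_mat A B"
      using assms by (simp only: is_drazin_def)
    from conjunct2 [OF this [unfolded dual_mat_mult dual_mat_eq_iff]] show ?thesis
      by (simp add: matrix_mul_minus matrix_mul_assoc)
  qed
  have "D ** B - D ** B ** D ** A = A ** D ** (D ** B - D ** B ** D ** A)"
    by (simp add: matrix_mul_diff_distrib matrix_mul_assoc AD)
  also have "\<dots> = A ** D ** (B ** D - A ** D ** B ** D)"
    by (simp add: eq)
  also have "\<dots> = 0"
    using idem by (simp add: matrix_mul_diff_distrib matrix_mul_assoc)
  finally show ?thesis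
    using eq by simp
qed

theorem theorem5p4:
  fixes A B :: "real^'n^'n" and m :: nat
  assumes "mat_index A = m"
    and "\<exists>X. is_drazin m (dual_mat A B) X"
    and "dual_drazin (dual_mat A B) = dual_mat (drazin A) (- (drazin A ** B ** drazin A))"
  shows "(\<exists>X. is_core_ep m (dual_mat A B) X) \<and>
    dual_core_ep (dual_mat A B) = dual_mat (core_ep A) (- (core_ep A ** B ** core_ep A))"
proof -
  define D where "D = drazin A"
  define X where "X = dual_mat D (- (D ** B ** D))"
  obtain X' where X': "is_drazin m (dual_mat A B) X'"
    using assms(2) by blast
  have "dual_drazin (dual_mat A B) = X'"
    unfolding dual_drazin_def
    using X' assms(1) is_drazin_unique by (auto intro!: the_equality)
  then have X: "is_drazin m (dual_mat A B) X"
    using X' assms(3) by (simp add: X_def D_def)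
  then have D: "is_drazin m A D"
    unfolding X_def by (rule is_drazin_standard_part)
  have range: "A ** D ** B ** D = B ** D"
    using X unfolding X_def by (rule drazin_perturbation_range)
  have MX: "dual_mat A B ** X = dual_mat (A ** D) 0"
    using range by (simp add: X_def dual_mat_mult matrix_mul_minus matrix_mul_assoc)
  have "A ** D ** (A ** D) = A ** D"
    using D by (metis is_drazin_def matrix_mul_assoc)
  then obtain Q where sym: "transpose Q = Q" and QP: "Q ** (A ** D) = A ** D"
    and PQ: "A ** D ** Q = Q"
    using ex_symmetric_projector_same_range by blast
  have "is_core_ep m A (D ** Q)"
    using D sym QP PQ by (rule is_core_ep_drazin_mult_projector)
  then have core: "core_ep A = D ** Q"
    unfolding core_ep_def using assms(1) is_core_ep_unique by (auto intro!: the_equality)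
  have dual_core: "is_core_ep m (dual_mat A B) (X ** dual_mat Q 0)"
  proof (rule is_core_ep_drazin_mult_projector [OF X])
    show "transpose (dual_mat Q 0) = dual_mat Q 0"
      by (simp add: transpose_dual_mat sym) (simp add: transpose_def vec_eq_iff)
  qed (use QP PQ in \<open>simp_all add: MX dual_mat_mult\<close>)
  have "Q ** B ** D = B ** D"
    using range QP by (metis matrix_mul_assoc)
  then have "D ** Q ** B ** (D ** Q) = D ** B ** D ** Q"
    by (metis matrix_mul_assoc)
  then have "X ** dual_mat Q 0 = dual_mat (core_ep A) (- (core_ep A ** B ** core_ep A))"
    by (simp add: X_def core dual_mat_mult matrix_mul_minus)
  moreover have "dual_core_ep (dual_mat A B) = X ** dual_mat Q 0"
    unfolding dual_core_ep_def
    using dual_core assms(1) is_core_ep_unique by (auto intro!: the_equality)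
  ultimately show ?thesis
    using dual_core by auto
qed

end
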